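(* Let $R$ be a commutative ring with $1\neq0$ and let $S\subseteq\operatorname{Reg}(R)$ be a nonempty multiplicative subset. The following are equivalent. (1) $S$ is strongly multiplicative. (2) Every element of $S$ is a unit. (3) $S\subseteq N_R(S)$. (4) $N_R(S)=\operatorname{Reg}(R)$. If, in addition, $S$ is saturated, then these are also equivalent to (5) $S=U(R)$. When these conditions hold, $R_S\cong R$ (via the localization map). In particular, identifying $R_S$ with $R$, for every family of ideals $(I_\lambda)_{\lambda\in\Lambda}$ of $R$, $\bigl(\bigcap_{\lambda\in\Lambda}I_\lambda\bigr)_S=\bigcap_{\lambda\in\Lambda}(I_\lambda)_S=\bigcap_{\lambda\in\Lambda}I_\lambda$.
   Context: $\operatorname{Reg}(R)=\{r\in R: rx=0\Rightarrow x=0\}$ is the set of non-zerodivisors of $R$ and $U(R)$ is the group of units. For nonempty $S\subseteq\operatorname{Reg}(R)$, $N_R(S)=\{x\in\operatorname{Reg}(R): xR\cap sR=xsR\text{ for all }s\in S\}$. A multiplicative set $S$ of $R$ is a subset with $0\notin S$, $1\in S$, closed under products; it is strongly multiplicative if $\bigl(\bigcap_{i\in\Delta}s_iR\bigr)\cap S\neq\varnothing$ for every family $(s_i)_{i\in\Delta}$ of elements of $S$. $S$ is saturated if $xy\in S$ implies $x\in S$ and $y\in S$. *)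

theory Defs
  imports "HOL-Algebra.Algebra"
begin

definition Reg :: "('a, 'm) ring_scheme \<Rightarrow> 'a set" where
  "Reg R = {r \<in> carrier R. \<forall>x \<in> carrier R. r \<otimes>\<^bsub>R\<^esub> x = \<zero>\<^bsub>R\<^esub> \<longrightarrow> x = \<zero>\<^bsub>R\<^esub>}"

definition Nset :: "('a, 'm) ring_scheme \<Rightarrow> 'a set \<Rightarrow> 'a set" where
  "Nset R S = {x \<in> Reg R. \<forall>s \<in> S. PIdl\<^bsub>R\<^esub> x \<inter> PIdl\<^bsub>R\<^esub> s = PIdl\<^bsub>R\<^esub> (x \<otimes>\<^bsub>R\<^esub> s)}"

definition multiplicative :: "('a, 'm) ring_scheme \<Rightarrow> 'a set \<Rightarrow> bool" where
  "multiplicative R S \<longleftrightarrow> submonoid S R \<and> \<zero>\<^bsub>R\<^esub> \<notin> S"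

text \<open>
  HOL cannot quantify over index types inside a definition. As the intersection over a family
  only depends on its set of members, the definition ranges over the subsets \<open>T\<close> of \<open>S\<close>;
  \<open>strongly_multiplicative_iff_families\<close> below is the version for families. For the empty family
  the intersection is read as \<open>R\<close>.
\<close>

definition strongly_multiplicative :: "('a, 'm) ring_scheme \<Rightarrow> 'a set \<Rightarrow> bool" where
  "strongly_multiplicative R S \<longleftrightarrow> multiplicative R S \<and>
     (\<forall>T \<subseteq> S. (carrier R \<inter> (\<Inter>t \<in> T. PIdl\<^bsub>R\<^esub> t)) \<inter> S \<noteq> {})"

definition saturated :: "('a, 'm) ring_scheme \<Rightarrow> 'a set \<Rightarrow> bool" where
  "saturated R S \<longleftrightarrow>
     (\<forall>x \<in> carrier R. \<forall>y \<in> carrier R. x \<otimes>\<^bsub>R\<^esub> y \<in> S \<longrightarrow> x \<in> S \<and> y \<in> S)"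

lemma strongly_multiplicative_family:
  assumes "strongly_multiplicative R S" "\<And>i. i \<in> \<Delta> \<Longrightarrow> s i \<in> S"
  shows "(carrier R \<inter> (\<Inter>i \<in> \<Delta>. PIdl\<^bsub>R\<^esub> (s i))) \<inter> S \<noteq> {}"
proof -
  have "s ` \<Delta> \<subseteq> S"
    using assms(2) by auto
  then have "(carrier R \<inter> (\<Inter>t \<in> s ` \<Delta>. PIdl\<^bsub>R\<^esub> t)) \<inter> S \<noteq> {}"
    using assms(1) unfolding strongly_multiplicative_def by blast
  then show ?thesis
    by simp
qed

lemma strongly_multiplicative_iff_families:
  "strongly_multiplicative R S \<longleftrightarrow> multiplicative R S \<and>
     (\<forall>(\<Delta> :: 'a set) s. (\<forall>i \<in> \<Delta>. s i \<in> S) \<longrightarrow>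
        (carrier R \<inter> (\<Inter>i \<in> \<Delta>. PIdl\<^bsub>R\<^esub> (s i))) \<inter> S \<noteq> {})"
  for R :: "('a, 'm) ring_scheme"
proof
  assume sm: "strongly_multiplicative R S"
  then show "multiplicative R S \<and>
     (\<forall>(\<Delta> :: 'a set) s. (\<forall>i \<in> \<Delta>. s i \<in> S) \<longrightarrow>
        (carrier R \<inter> (\<Inter>i \<in> \<Delta>. PIdl\<^bsub>R\<^esub> (s i))) \<inter> S \<noteq> {})"
    by (intro conjI allI impI strongly_multiplicative_family[OF sm])
       (auto simp: strongly_multiplicative_def)
next
  assume fam: "multiplicative R S \<and>
     (\<forall>(\<Delta> :: 'a set) s. (\<forall>i \<in> \<Delta>. s i \<in> S) \<longrightarrow>
        (carrier R \<inter> (\<Inter>i \<in> \<Delta>. PIdl\<^bsub>R\<^esub> (s i))) \<inter> S \<noteq> {})"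
  show "strongly_multiplicative R S"
    unfolding strongly_multiplicative_def
  proof (intro conjI allI impI)
    show "multiplicative R S"
      using fam by simp
  next
    fix T assume "T \<subseteq> S"
    then show "(carrier R \<inter> (\<Inter>t \<in> T. PIdl\<^bsub>R\<^esub> t)) \<inter> S \<noteq> {}"
      by (intro fam[THEN conjunct2, rule_format, of T "\<lambda>t. t"]) auto
  qed
qed


definition loc_rel :: "('a, 'm) ring_scheme \<Rightarrow> 'a set \<Rightarrow> (('a \<times> 'a) \<times> ('a \<times> 'a)) set" where
  "loc_rel R S = {((a, s), (b, t)) | a s b t.
     a \<in> carrier R \<and> s \<in> S \<and> b \<in> carrier R \<and> t \<in> S \<and>
     (\<exists>u \<in> S. u \<otimes>\<^bsub>R\<^esub> (a \<otimes>\<^bsub>R\<^esub> t \<ominus>\<^bsub>R\<^esub> b \<otimes>\<^bsub>R\<^esub> s) = \<zero>\<^bsub>R\<^esub>)}"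

definition loc_frac :: "('a, 'm) ring_scheme \<Rightarrow> 'a set \<Rightarrow> 'a \<Rightarrow> 'a \<Rightarrow> ('a \<times> 'a) set" where
  "loc_frac R S a s = loc_rel R S `` {(a, s)}"

text \<open>
  The unions below run over all representatives; all members of such a union are the same class,
  see \<open>localization_mult\<close> and \<open>localization_add\<close>.
\<close>

definition localization :: "('a, 'm) ring_scheme \<Rightarrow> 'a set \<Rightarrow> ('a \<times> 'a) set ring" where
  "localization R S =
     \<lparr> carrier = (carrier R \<times> S) // loc_rel R S,
       monoid.mult = (\<lambda>P Q. \<Union>(a, s) \<in> P. \<Union>(b, t) \<in> Q. loc_frac R S (a \<otimes>\<^bsub>R\<^esub> b) (s \<otimes>\<^bsub>R\<^esub> t)),
       monoid.one = loc_frac R S \<one>\<^bsub>R\<^esub> \<one>\<^bsub>R\<^esub>,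
       ring.zero = loc_frac R S \<zero>\<^bsub>R\<^esub> \<one>\<^bsub>R\<^esub>,
       ring.add = (\<lambda>P Q. \<Union>(a, s) \<in> P. \<Union>(b, t) \<in> Q.
                loc_frac R S (a \<otimes>\<^bsub>R\<^esub> t \<oplus>\<^bsub>R\<^esub> b \<otimes>\<^bsub>R\<^esub> s) (s \<otimes>\<^bsub>R\<^esub> t)) \<rparr>"

definition loc_map :: "('a, 'm) ring_scheme \<Rightarrow> 'a set \<Rightarrow> 'a \<Rightarrow> ('a \<times> 'a) set" where
  "loc_map R S a = loc_frac R S a \<one>\<^bsub>R\<^esub>"

definition loc_ideal :: "('a, 'm) ring_scheme \<Rightarrow> 'a set \<Rightarrow> 'a set \<Rightarrow> ('a \<times> 'a) set set" where
  "loc_ideal R S I = {loc_frac R S a s | a s. a \<in> I \<and> s \<in> S}"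

locale ring_localization = cring R + submonoid S R for R (structure) and S
begin

lemma in_carrier [simp]: "s \<in> S \<Longrightarrow> s \<in> carrier R"
  using subset by blast

lemma loc_rel_iff:
  "((a, s), (b, t)) \<in> loc_rel R S \<longleftrightarrow>
     a \<in> carrier R \<and> s \<in> S \<and> b \<in> carrier R \<and> t \<in> S \<and>
     (\<exists>u \<in> S. u \<otimes> (a \<otimes> t) = u \<otimes> (b \<otimes> s))"
proof -
  have "u \<otimes> (a \<otimes> t \<ominus> b \<otimes> s) = \<zero> \<longleftrightarrow> u \<otimes> (a \<otimes> t) = u \<otimes> (b \<otimes> s)"
    if "a \<in> carrier R" "s \<in> S" "b \<in> carrier R" "t \<in> S" "u \<in> S" for u
  proof -
    have "u \<otimes> (a \<otimes> t \<ominus> b \<otimes> s) = u \<otimes> (a \<otimes> t) \<ominus> u \<otimes> (b \<otimes> s)"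
      using that by (simp add: a_minus_def r_distr r_minus)
    then show ?thesis
      using that by (simp add: r_right_minus_eq)
  qed
  then show ?thesis
    unfolding loc_rel_def by auto
qed

lemma loc_rel_trans:
  assumes "((a, s), (b, t)) \<in> loc_rel R S" "((b, t), (c, v)) \<in> loc_rel R S"
  shows "((a, s), (c, v)) \<in> loc_rel R S"
proof -
  obtain u where u: "u \<in> S" "u \<otimes> (a \<otimes> t) = u \<otimes> (b \<otimes> s)"
    and c: "a \<in> carrier R" "s \<in> S" "b \<in> carrier R" "t \<in> S"
    using assms(1) by (auto simp: loc_rel_iff)
  obtain w where w: "w \<in> S" "w \<otimes> (b \<otimes> v) = w \<otimes> (c \<otimes> t)"
    and d: "c \<in> carrier R" "v \<in> S"
    using assms(2) by (auto simp: loc_rel_iff)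
  have "(u \<otimes> (w \<otimes> t)) \<otimes> (a \<otimes> v) = (w \<otimes> v) \<otimes> (u \<otimes> (a \<otimes> t))"
    using u(1) w(1) c d by (simp add: m_ac)
  also have "\<dots> = (u \<otimes> s) \<otimes> (w \<otimes> (b \<otimes> v))"
    unfolding u(2) using u(1) w(1) c d by (simp add: m_ac)
  also have "\<dots> = (u \<otimes> (w \<otimes> t)) \<otimes> (c \<otimes> s)"
    unfolding w(2) using u(1) w(1) c d by (simp add: m_ac)
  finally show ?thesis
    using u(1) w(1) c d by (auto simp: loc_rel_iff intro!: bexI[of _ "u \<otimes> (w \<otimes> t)"])
qed

lemma equiv_loc_rel: "equiv (carrier R \<times> S) (loc_rel R S)"
proof (rule equivI)
  show "loc_rel R S \<subseteq> (carrier R \<times> S) \<times> (carrier R \<times> S)"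
    by (auto simp: loc_rel_def)
  show "refl_on (carrier R \<times> S) (loc_rel R S)"
    by (auto simp: refl_on_def loc_rel_iff)
  show "sym (loc_rel R S)"
  proof (rule symI)
    fix p q assume "(p, q) \<in> loc_rel R S"
    moreover obtain a s b t where "p = (a, s)" "q = (b, t)"
      by (cases p, cases q)
    ultimately show "(q, p) \<in> loc_rel R S"
      by (simp add: loc_rel_iff) (blast intro: sym)
  qed
  show "trans (loc_rel R S)"
    by (auto intro!: transI dest: loc_rel_trans)
qed

lemma loc_frac_eq_iff:
  assumes "a \<in> carrier R" "s \<in> S" "b \<in> carrier R" "t \<in> S"
  shows "loc_frac R S a s = loc_frac R S b t \<longleftrightarrow> (\<exists>u \<in> S. u \<otimes> (a \<otimes> t) = u \<otimes> (b \<otimes> s))"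
  unfolding loc_frac_def using eq_equiv_class_iff[OF equiv_loc_rel, of "(a, s)" "(b, t)"] assms
  by (simp add: loc_rel_iff)

lemma carrier_localization: "carrier (localization R S) = {loc_frac R S a s | a s. a \<in> carrier R \<and> s \<in> S}"
  by (auto simp: localization_def loc_frac_def quotient_def)

lemma loc_frac_cong2:
  assumes "((a, s), (a', s')) \<in> loc_rel R S" "((b, t), (b', t')) \<in> loc_rel R S"
  shows "loc_frac R S (a \<otimes> b) (s \<otimes> t) = loc_frac R S (a' \<otimes> b') (s' \<otimes> t')"
    and "loc_frac R S (a \<otimes> t \<oplus> b \<otimes> s) (s \<otimes> t) = loc_frac R S (a' \<otimes> t' \<oplus> b' \<otimes> s') (s' \<otimes> t')"
proof -
  obtain u where u: "u \<in> S" "u \<otimes> (a \<otimes> s') = u \<otimes> (a' \<otimes> s)"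
    and c: "a \<in> carrier R" "s \<in> S" "a' \<in> carrier R" "s' \<in> S"
    using assms(1) by (auto simp: loc_rel_iff)
  obtain w where w: "w \<in> S" "w \<otimes> (b \<otimes> t') = w \<otimes> (b' \<otimes> t)"
    and d: "b \<in> carrier R" "t \<in> S" "b' \<in> carrier R" "t' \<in> S"
    using assms(2) by (auto simp: loc_rel_iff)
  note simps = u(1) w(1) c d
  have "(u \<otimes> w) \<otimes> ((a \<otimes> b) \<otimes> (s' \<otimes> t')) = (u \<otimes> (a \<otimes> s')) \<otimes> (w \<otimes> (b \<otimes> t'))"
    using simps by (simp add: m_ac)
  also have "\<dots> = (u \<otimes> w) \<otimes> ((a' \<otimes> b') \<otimes> (s \<otimes> t))"
    unfolding u(2) w(2) using simps by (simp add: m_ac)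
  finally show "loc_frac R S (a \<otimes> b) (s \<otimes> t) = loc_frac R S (a' \<otimes> b') (s' \<otimes> t')"
    using simps by (subst loc_frac_eq_iff) (auto intro!: bexI[of _ "u \<otimes> w"])
  have "(u \<otimes> w) \<otimes> ((a \<otimes> t \<oplus> b \<otimes> s) \<otimes> (s' \<otimes> t')) =
      (u \<otimes> (a \<otimes> s')) \<otimes> (w \<otimes> (t \<otimes> t')) \<oplus> (w \<otimes> (b \<otimes> t')) \<otimes> (u \<otimes> (s \<otimes> s'))"
    using simps by (simp add: m_ac l_distr r_distr)
  also have "\<dots> = (u \<otimes> w) \<otimes> ((a' \<otimes> t' \<oplus> b' \<otimes> s') \<otimes> (s \<otimes> t))"
    unfolding u(2) w(2) using simps by (simp add: m_ac l_distr r_distr)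
  finally show "loc_frac R S (a \<otimes> t \<oplus> b \<otimes> s) (s \<otimes> t) = loc_frac R S (a' \<otimes> t' \<oplus> b' \<otimes> s') (s' \<otimes> t')"
    using simps by (subst loc_frac_eq_iff) (auto intro!: bexI[of _ "u \<otimes> w"])
qed

lemma UN_loc_frac:
  assumes "a \<in> carrier R" "s \<in> S" "b \<in> carrier R" "t \<in> S"
    and "\<And>a' s' b' t'. ((a, s), (a', s')) \<in> loc_rel R S \<Longrightarrow> ((b, t), (b', t')) \<in> loc_rel R S \<Longrightarrow>
           f a s b t = f a' s' b' t'"
  shows "(\<Union>(a', s') \<in> loc_frac R S a s. \<Union>(b', t') \<in> loc_frac R S b t. f a' s' b' t') = f a s b t"
proof -
  have refl: "((a, s), (a, s)) \<in> loc_rel R S" "((b, t), (b, t)) \<in> loc_rel R S"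
    using assms(1-4) by (auto simp: loc_rel_iff)
  have "(a, s) \<in> loc_frac R S a s" "(b, t) \<in> loc_frac R S b t"
    using refl by (simp_all add: loc_frac_def)
  then have ne: "loc_frac R S a s \<noteq> {}" "loc_frac R S b t \<noteq> {}"
    by auto
  have "(\<Union>(b', t') \<in> loc_frac R S b t. f a' s' b' t') = f a s b t"
    if a': "(a', s') \<in> loc_frac R S a s" for a' s'
  proof (rule SUP_eq_const[OF ne(2)])
    fix q assume "q \<in> loc_frac R S b t"
    moreover obtain b' t' where "q = (b', t')"
      by (cases q)
    ultimately show "(case q of (b', t') \<Rightarrow> f a' s' b' t') = f a s b t"
      using assms(5)[of a' s' b' t'] a' by (simp add: loc_frac_def)
  qed
  then show ?thesis
    by (intro SUP_eq_const[OF ne(1)]) auto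
qed

lemma localization_mult:
  assumes "a \<in> carrier R" "s \<in> S" "b \<in> carrier R" "t \<in> S"
  shows "loc_frac R S a s \<otimes>\<^bsub>localization R S\<^esub> loc_frac R S b t = loc_frac R S (a \<otimes> b) (s \<otimes> t)"
proof -
  let ?f = "\<lambda>a s b t. loc_frac R S (a \<otimes> b) (s \<otimes> t)"
  have "loc_frac R S a s \<otimes>\<^bsub>localization R S\<^esub> loc_frac R S b t =
      (\<Union>(a', s') \<in> loc_frac R S a s. \<Union>(b', t') \<in> loc_frac R S b t. ?f a' s' b' t')"
    by (simp only: localization_def partial_object.simps monoid.simps ring.simps)
  also have "\<dots> = ?f a s b t"
    using assms loc_frac_cong2(1) by (rule UN_loc_frac[of _ _ _ _ ?f])
  finally show ?thesis .
qed

lemma localization_add: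
  assumes "a \<in> carrier R" "s \<in> S" "b \<in> carrier R" "t \<in> S"
  shows "loc_frac R S a s \<oplus>\<^bsub>localization R S\<^esub> loc_frac R S b t = loc_frac R S (a \<otimes> t \<oplus> b \<otimes> s) (s \<otimes> t)"
proof -
  let ?f = "\<lambda>a s b t. loc_frac R S (a \<otimes> t \<oplus> b \<otimes> s) (s \<otimes> t)"
  have "loc_frac R S a s \<oplus>\<^bsub>localization R S\<^esub> loc_frac R S b t =
      (\<Union>(a', s') \<in> loc_frac R S a s. \<Union>(b', t') \<in> loc_frac R S b t. ?f a' s' b' t')"
    by (simp only: localization_def partial_object.simps monoid.simps ring.simps)
  also have "\<dots> = ?f a s b t"
    using assms loc_frac_cong2(2) by (rule UN_loc_frac[of _ _ _ _ ?f])
  finally show ?thesis .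
qed

lemma localization_zero: "\<zero>\<^bsub>localization R S\<^esub> = loc_frac R S \<zero> \<one>"
  and localization_one: "\<one>\<^bsub>localization R S\<^esub> = loc_frac R S \<one> \<one>"
  by (simp_all add: localization_def)

lemma loc_frac_eqI:
  assumes "a \<in> carrier R" "s \<in> S" "b \<in> carrier R" "t \<in> S" "a \<otimes> t = b \<otimes> s"
  shows "loc_frac R S a s = loc_frac R S b t"
  using assms by (simp add: loc_frac_eq_iff) (blast intro: one_closed)

lemma loc_frac_closed:
  assumes "a \<in> carrier R" "s \<in> S"
  shows "loc_frac R S a s \<in> carrier (localization R S)"
  using assms unfolding carrier_localization by blast

lemma loc_fracE:
  assumes "x \<in> carrier (localization R S)"
  obtains a s where "x = loc_frac R S a s" "a \<in> carrier R" "s \<in> S"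
  using assms unfolding carrier_localization by blast

lemmas localization_ops = localization_mult localization_add localization_zero localization_one
  loc_frac_closed

lemma cring_localization: "cring (localization R S)"
proof (rule cringI)
  let ?L = "localization R S"
  show "abelian_group ?L"
  proof (rule abelian_groupI)
    show "\<zero>\<^bsub>?L\<^esub> \<in> carrier ?L"
      by (simp add: localization_ops)
    fix x assume "x \<in> carrier ?L"
    then obtain a s where x: "x = loc_frac R S a s" "a \<in> carrier R" "s \<in> S"
      by (rule loc_fracE)
    show "\<zero>\<^bsub>?L\<^esub> \<oplus>\<^bsub>?L\<^esub> x = x"
      using x(2,3) unfolding x(1) by (simp add: localization_ops)
    have "loc_frac R S (\<ominus> a \<otimes> s \<oplus> a \<otimes> s) (s \<otimes> s) = loc_frac R S \<zero> \<one>"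
      using x(2,3) by (intro loc_frac_eqI) (simp_all add: l_minus l_neg)
    then have "loc_frac R S (\<ominus> a) s \<oplus>\<^bsub>?L\<^esub> x = \<zero>\<^bsub>?L\<^esub>"
      using x(2,3) unfolding x(1) by (simp add: localization_ops)
    then show "\<exists>y \<in> carrier ?L. y \<oplus>\<^bsub>?L\<^esub> x = \<zero>\<^bsub>?L\<^esub>"
      using x by (intro bexI[of _ "loc_frac R S (\<ominus> a) s"] loc_frac_closed) simp_all
    fix y assume "y \<in> carrier ?L"
    then obtain b t where y: "y = loc_frac R S b t" "b \<in> carrier R" "t \<in> S"
      by (rule loc_fracE)
    show "x \<oplus>\<^bsub>?L\<^esub> y \<in> carrier ?L"
      using x(2,3) y(2,3) unfolding x(1) y(1) by (simp add: localization_ops)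
    show "x \<oplus>\<^bsub>?L\<^esub> y = y \<oplus>\<^bsub>?L\<^esub> x"
      using x(2,3) y(2,3) unfolding x(1) y(1) by (simp add: localization_ops m_comm a_comm)
    fix z assume "z \<in> carrier ?L"
    then obtain c v where z: "z = loc_frac R S c v" "c \<in> carrier R" "v \<in> S"
      by (rule loc_fracE)
    show "(x \<oplus>\<^bsub>?L\<^esub> y) \<oplus>\<^bsub>?L\<^esub> z = x \<oplus>\<^bsub>?L\<^esub> (y \<oplus>\<^bsub>?L\<^esub> z)"
      using x(2,3) y(2,3) z(2,3) unfolding x(1) y(1) z(1)
      by (simp add: localization_ops m_ac a_ac l_distr r_distr)
  qed
  show "Group.comm_monoid ?L"
  proof (rule comm_monoidI)
    show "\<one>\<^bsub>?L\<^esub> \<in> carrier ?L"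
      by (simp add: localization_ops)
    fix x assume "x \<in> carrier ?L"
    then obtain a s where x: "x = loc_frac R S a s" "a \<in> carrier R" "s \<in> S"
      by (rule loc_fracE)
    show "\<one>\<^bsub>?L\<^esub> \<otimes>\<^bsub>?L\<^esub> x = x"
      using x(2,3) unfolding x(1) by (simp add: localization_ops)
    fix y assume "y \<in> carrier ?L"
    then obtain b t where y: "y = loc_frac R S b t" "b \<in> carrier R" "t \<in> S"
      by (rule loc_fracE)
    show "x \<otimes>\<^bsub>?L\<^esub> y \<in> carrier ?L"
      using x(2,3) y(2,3) unfolding x(1) y(1) by (simp add: localization_ops)
    show "x \<otimes>\<^bsub>?L\<^esub> y = y \<otimes>\<^bsub>?L\<^esub> x"
      using x(2,3) y(2,3) unfolding x(1) y(1) by (simp add: localization_ops m_comm)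
    fix z assume "z \<in> carrier ?L"
    then obtain c v where z: "z = loc_frac R S c v" "c \<in> carrier R" "v \<in> S"
      by (rule loc_fracE)
    show "(x \<otimes>\<^bsub>?L\<^esub> y) \<otimes>\<^bsub>?L\<^esub> z = x \<otimes>\<^bsub>?L\<^esub> (y \<otimes>\<^bsub>?L\<^esub> z)"
      using x(2,3) y(2,3) z(2,3) unfolding x(1) y(1) z(1) by (simp add: localization_ops m_assoc)
  qed
  fix x y z assume "x \<in> carrier ?L" "y \<in> carrier ?L" "z \<in> carrier ?L"
  then obtain a s b t c v
    where x: "x = loc_frac R S a s" "a \<in> carrier R" "s \<in> S"
      and y: "y = loc_frac R S b t" "b \<in> carrier R" "t \<in> S"
      and z: "z = loc_frac R S c v" "c \<in> carrier R" "v \<in> S"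
    by (elim loc_fracE)
  have "loc_frac R S ((a \<otimes> t \<oplus> b \<otimes> s) \<otimes> c) ((s \<otimes> t) \<otimes> v) =
      loc_frac R S ((a \<otimes> c) \<otimes> (t \<otimes> v) \<oplus> (b \<otimes> c) \<otimes> (s \<otimes> v)) ((s \<otimes> v) \<otimes> (t \<otimes> v))"
    using x(2,3) y(2,3) z(2,3) by (intro loc_frac_eqI) (simp_all add: m_ac l_distr r_distr)
  then show "(x \<oplus>\<^bsub>?L\<^esub> y) \<otimes>\<^bsub>?L\<^esub> z = x \<otimes>\<^bsub>?L\<^esub> z \<oplus>\<^bsub>?L\<^esub> y \<otimes>\<^bsub>?L\<^esub> z"
    using x(2,3) y(2,3) z(2,3) unfolding x(1) y(1) z(1) by (simp add: localization_ops)
qed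

lemma loc_map_hom: "loc_map R S \<in> ring_hom R (localization R S)"
  by (rule ring_hom_memI) (simp_all add: loc_map_def localization_ops)

end

end

theory Submission
  imports Defs
begin

text \<open>
  An element \<open>t\<close> of \<open>S\<close> that lies in \<open>t\<^sup>2R\<close> is a unit, because \<open>t\<close> is a non-zerodivisor. The
  relation \<open>tR = t\<^sup>2R\<close> is the condition \<open>t \<in> N(S)\<close> tested at \<open>t\<close> itself, and it also holds for
  every \<open>t \<in> S\<close> that is a common multiple of \<open>S\<close>, since \<open>t\<^sup>2 \<in> S\<close>.
\<close>

lemma (in cring) mem_PIdl_iff: "y \<in> PIdl x \<longleftrightarrow> (\<exists>r \<in> carrier R. y = r \<otimes> x)"
  by (auto simp: cgenideal_def)

lemma (in cring) Units_if_mem_PIdl_square: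
  assumes "t \<in> Reg R" "t \<in> PIdl (t \<otimes> t)"
  shows "t \<in> Units R"
proof -
  have t: "t \<in> carrier R"
    using assms(1) by (simp add: Reg_def)
  obtain r where r: "r \<in> carrier R" "t = r \<otimes> (t \<otimes> t)"
    using assms(2) by (auto simp: mem_PIdl_iff)
  \<comment> \<open>The equation \<open>t = r \<otimes> (t \<otimes> t)\<close> is put in the form
    t(rt - 1) = 0, to which regularity of \<open>t\<close> applies.\<close>
  have "t \<otimes> (r \<otimes> t \<ominus> \<one>) = r \<otimes> (t \<otimes> t) \<ominus> t"
    using r(1) t by (simp add: a_minus_def r_distr r_minus m_ac)
  also have "\<dots> = \<zero>"
    using r t by (metis r_right_minus_eq)
  finally have "r \<otimes> t \<ominus> \<one> = \<zero>"
    using assms(1) r(1) t by (simp add: Reg_def)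
  then have "r \<otimes> t = \<one>"
    using r(1) t by (simp add: r_right_minus_eq)
  then show ?thesis
    using r(1) t m_comm unfolding Units_def by fastforce
qed

lemma (in cring) PIdl_unit: "u \<in> Units R \<Longrightarrow> PIdl u = carrier R"
  by (metis Units_closed Units_l_inv_ex cgenideal_ideal ideal.one_imp_carrier mem_PIdl_iff)

lemma (in cring) PIdl_mult_unit:
  assumes "x \<in> carrier R" "u \<in> Units R"
  shows "PIdl (x \<otimes> u) = PIdl x"
proof (intro equalityI subsetI)
  fix y assume "y \<in> PIdl (x \<otimes> u)"
  then obtain r where "r \<in> carrier R" "y = (r \<otimes> u) \<otimes> x"
    using assms by (auto simp: mem_PIdl_iff m_ac)
  then show "y \<in> PIdl x"
    using assms mem_PIdl_iff by blast
next
  fix y assume "y \<in> PIdl x"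
  then obtain r where r: "r \<in> carrier R" "y = r \<otimes> x"
    by (auto simp: mem_PIdl_iff)
  have "(r \<otimes> inv u) \<otimes> (x \<otimes> u) = (r \<otimes> x) \<otimes> (inv u \<otimes> u)"
    using r(1) assms by (simp add: m_ac Units_closed del: Units_l_inv Units_r_inv)
  also have "\<dots> = y"
    using r assms by simp
  finally show "y \<in> PIdl (x \<otimes> u)"
    using r(1) assms by (auto simp: mem_PIdl_iff intro!: bexI[of _ "r \<otimes> inv u"])
qed

lemma (in cring) PIdl_subset_carrier: "x \<in> carrier R \<Longrightarrow> PIdl x \<subseteq> carrier R"
  by (auto simp: cgenideal_def)

text \<open>If \<open>s\<close> is a unit, then sR = R and xsR = xR, so the condition on
  \<open>x\<close> reads xR = xR.\<close>

lemma (in cring) Nset_eq_Reg: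
  assumes "S \<subseteq> Units R"
  shows "Nset R S = Reg R"
proof -
  have "PIdl x \<inter> PIdl s = PIdl (x \<otimes> s)" if "x \<in> Reg R" "s \<in> S" for x s
    using that assms PIdl_subset_carrier[of x]
    by (auto simp: PIdl_unit PIdl_mult_unit subset_iff Reg_def)
  then show ?thesis
    by (auto simp: Nset_def)
qed

lemma (in cring) Units_if_subset_Nset:
  assumes "S \<subseteq> Nset R S"
  shows "S \<subseteq> Units R"
proof
  fix s assume "s \<in> S"
  then have s: "s \<in> Reg R" "PIdl s = PIdl (s \<otimes> s)"
    using assms by (auto simp: Nset_def)
  moreover have "s \<in> PIdl s"
    using s(1) by (simp add: Reg_def cgenideal_self)
  ultimately show "s \<in> Units R"
    using Units_if_mem_PIdl_square by metis
qed

lemma (in cring) strongly_multiplicative_iff_Units: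
  assumes "multiplicative R S" "S \<subseteq> Reg R"
  shows "strongly_multiplicative R S \<longleftrightarrow> S \<subseteq> Units R"
proof
  interpret submonoid S R
    using assms(1) by (simp add: multiplicative_def)
  show "S \<subseteq> Units R" if sm: "strongly_multiplicative R S"
  proof
    \<comment> \<open>The family is taken to be all of \<open>S\<close>, so that \<open>t\<close> is
      a common multiple of \<open>S\<close> inside \<open>S\<close>.\<close>
    obtain t where t: "t \<in> S" "\<And>s. s \<in> S \<Longrightarrow> t \<in> PIdl s"
      using sm unfolding strongly_multiplicative_def by blast
    have tU: "t \<in> Units R"
      using t assms(2) by (auto intro!: Units_if_mem_PIdl_square)
    fix s assume s: "s \<in> S"
    \<comment> \<open>Each \<open>s\<close> divides the unit \<open>t\<close>, and divisors of units
      are units.\<close>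
    then obtain r where "r \<in> carrier R" "t = r \<otimes> s"
      using t(2) mem_PIdl_iff by blast
    then show "s \<in> Units R"
      using tU s mem_carrier unit_factor[of s r] m_comm by metis
  qed
  show "strongly_multiplicative R S" if U: "S \<subseteq> Units R"
  proof -
    \<comment> \<open>Principal ideals of units are the whole ring, so \<open>\<one>\<close> serves
      every family. The factor \<open>carrier R\<close> covers the empty one.\<close>
    have "\<one> \<in> (carrier R \<inter> (\<Inter>t \<in> T. PIdl t)) \<inter> S" if "T \<subseteq> S" for T
      using that U by (auto simp: PIdl_unit subset_iff)
    then show ?thesis
      using assms(1) unfolding strongly_multiplicative_def by blast
  qed
qed

text \<open>Every unit divides \<open>\<one>\<close>, which lies in \<open>S\<close>; saturation
  passes from the product to the factor.\<close>

lemma (in cring) saturated_eq_Units: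
  assumes "submonoid S R" "saturated R S" "S \<subseteq> Units R"
  shows "S = Units R"
proof
  show "Units R \<subseteq> S"
  proof
    fix u assume u: "u \<in> Units R"
    then have "u \<otimes> inv u \<in> S"
      using submonoid.one_closed[OF assms(1)] by simp
    then show "u \<in> S"
      using u assms(2) unfolding saturated_def by blast
  qed
qed (fact assms(3))

context ring_localization
begin

text \<open>Denominators that are units can be absorbed into the numerator. This yields surjectivity
  of the localization map, also at the level of ideals.\<close>

lemma loc_frac_eq_loc_map:
  assumes "S \<subseteq> Units R" "a \<in> carrier R" "s \<in> S"
  shows "loc_frac R S a s = loc_map R S (a \<otimes> inv s)"
proof -
  have s: "s \<in> Units R"
    using assms by blast
  then have "a \<otimes> inv s \<otimes> s = a"
    using assms(2) by (simp add: m_assoc Units_closed)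
  then show ?thesis
    unfolding loc_map_def using assms(2,3) s by (intro loc_frac_eqI) auto
qed

text \<open>Equality of a/1 and b/1 means ua = ub for some \<open>u\<close> in \<open>S\<close>, and
  a unit \<open>u\<close> cancels.\<close>

lemma inj_on_loc_map:
  assumes "S \<subseteq> Units R"
  shows "inj_on (loc_map R S) (carrier R)"
proof (rule inj_onI)
  fix a b assume ab: "a \<in> carrier R" "b \<in> carrier R" "loc_map R S a = loc_map R S b"
  then obtain u where "u \<in> S" "u \<otimes> a = u \<otimes> b"
    by (auto simp: loc_map_def loc_frac_eq_iff)
  then show "a = b"
    using assms ab Units_l_cancel by blast
qed

text \<open>For \<open>a\<close> in \<open>I\<close> the element \<open>a \<otimes> inv s\<close> is
  again in \<open>I\<close>, so a/s is the image of an element of \<open>I\<close>. Conversely, the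
  denominator \<open>\<one>\<close> suffices.\<close>

lemma loc_ideal_eq_image:
  assumes "S \<subseteq> Units R" "ideal I R"
  shows "loc_ideal R S I = loc_map R S ` I"
proof
  interpret ideal I R by fact
  show "loc_ideal R S I \<subseteq> loc_map R S ` I"
    using assms(1)
    by (auto simp: loc_ideal_def loc_frac_eq_loc_map subset_iff intro!: imageI I_r_closed)
  show "loc_map R S ` I \<subseteq> loc_ideal R S I"
    by (force simp: loc_ideal_def loc_map_def)
qed

text \<open>This is the case of the unit ideal, whose localization consists of all
  fractions.\<close>

lemma loc_map_surj:
  assumes "S \<subseteq> Units R"
  shows "loc_map R S ` carrier R = carrier (localization R S)"
  using loc_ideal_eq_image[OF assms oneideal] by (simp add: loc_ideal_def carrier_localization)

lemma loc_map_iso: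
  assumes "S \<subseteq> Units R"
  shows "loc_map R S \<in> ring_iso R (localization R S)"
  using loc_map_hom inj_on_loc_map[OF assms] loc_map_surj[OF assms]
  by (simp add: ring_iso_def bij_betw_def)

text \<open>Both sides are compared through the image of the intersection: localizing an ideal is
  taking its image, and an injective map commutes with nonempty intersections.\<close>

lemma loc_ideal_INT:
  assumes U: "S \<subseteq> Units R" and I: "\<And>l. l \<in> \<Lambda> \<Longrightarrow> ideal (I l) R"
  shows "loc_ideal R S (carrier R \<inter> (\<Inter>l \<in> \<Lambda>. I l)) = loc_map R S ` (carrier R \<inter> (\<Inter>l \<in> \<Lambda>. I l))"
    and "carrier (localization R S) \<inter> (\<Inter>l \<in> \<Lambda>. loc_ideal R S (I l)) =
      loc_map R S ` (carrier R \<inter> (\<Inter>l \<in> \<Lambda>. I l))"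
proof -
  \<comment> \<open>Inserting \<open>carrier R\<close> keeps the family nonempty even when
    \<open>\<Lambda>\<close> is empty, and leaves the intersection inside R unchanged.\<close>
  have "ideal (\<Inter> (insert (carrier R) (I ` \<Lambda>))) R"
    using I oneideal by (intro i_Intersect) auto
  then show "loc_ideal R S (carrier R \<inter> (\<Inter>l \<in> \<Lambda>. I l)) = loc_map R S ` (carrier R \<inter> (\<Inter>l \<in> \<Lambda>. I l))"
    using U by (intro loc_ideal_eq_image) simp_all
  have "I l \<subseteq> carrier R" if "l \<in> \<Lambda>" for l
    using I[OF that] by (simp add: ideal.Icarr subsetI)
  then have "loc_map R S ` (\<Inter>J \<in> insert (carrier R) (I ` \<Lambda>). J) =
      (\<Inter>J \<in> insert (carrier R) (I ` \<Lambda>). loc_map R S ` J)"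
    by (intro image_INT[OF inj_on_loc_map[OF U], of _ _ "carrier R"]) auto
  then show "carrier (localization R S) \<inter> (\<Inter>l \<in> \<Lambda>. loc_ideal R S (I l)) =
      loc_map R S ` (carrier R \<inter> (\<Inter>l \<in> \<Lambda>. I l))"
    using U I by (simp add: loc_map_surj loc_ideal_eq_image)
qed

end

text \<open>The identification of the localization with R is made explicit by
  \<open>loc_map\<close>, so the last equality takes place in the localization. Intersections are
  cut with the carrier, which makes the empty family give the whole ring.\<close>

theorem theorem7p2:
  fixes R :: "('a, 'm) ring_scheme" (structure)
    and S :: "'a set"
  assumes "cring R"
    and "\<one> \<noteq> \<zero>"
    and "S \<noteq> {}"
    and "S \<subseteq> Reg R"
    and "multiplicative R S"
  shows
    "(strongly_multiplicative R S \<longleftrightarrow> (\<forall>s \<in> S. s \<in> Units R)) \<and>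
     ((\<forall>s \<in> S. s \<in> Units R) \<longleftrightarrow> S \<subseteq> Nset R S) \<and>
     (S \<subseteq> Nset R S \<longleftrightarrow> Nset R S = Reg R) \<and>
     (saturated R S \<longrightarrow> (Nset R S = Reg R \<longleftrightarrow> S = Units R)) \<and>
     (strongly_multiplicative R S \<longrightarrow>
        loc_map R S \<in> ring_iso R (localization R S) \<and>
        (\<forall>(\<Lambda> :: 'i set) I. (\<forall>l \<in> \<Lambda>. ideal (I l) R) \<longrightarrow>
           loc_ideal R S (carrier R \<inter> (\<Inter>l \<in> \<Lambda>. I l)) =
             carrier (localization R S) \<inter> (\<Inter>l \<in> \<Lambda>. loc_ideal R S (I l)) \<and>
           carrier (localization R S) \<inter> (\<Inter>l \<in> \<Lambda>. loc_ideal R S (I l)) =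
             loc_map R S ` (carrier R \<inter> (\<Inter>l \<in> \<Lambda>. I l))))"
proof -
  interpret ring_localization R S
    using assms unfolding ring_localization_def multiplicative_def by simp
  have sm: "strongly_multiplicative R S \<longleftrightarrow> S \<subseteq> Units R"
    using assms(5,4) by (rule strongly_multiplicative_iff_Units)
  \<comment> \<open>The implications form a cycle: units give \<open>Nset R S = Reg R\<close>, then
    \<open>S \<subseteq> Reg R\<close> gives \<open>S \<subseteq> Nset R S\<close>, which gives
    units again.\<close>
  have N: "S \<subseteq> Units R \<longleftrightarrow> S \<subseteq> Nset R S" "S \<subseteq> Nset R S \<longleftrightarrow> Nset R S = Reg R"
    using Nset_eq_Reg[of S] Units_if_subset_Nset[of S] assms(4) by auto
  have sat: "S \<subseteq> Units R \<longleftrightarrow> S = Units R" if "saturated R S"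
    using saturated_eq_Units[OF submonoid_axioms that] by blast
  have U: "(\<forall>s \<in> S. s \<in> Units R) \<longleftrightarrow> S \<subseteq> Units R"
    by blast
  show ?thesis
    unfolding sm U
  proof (intro conjI impI allI)
    assume "S \<subseteq> Units R"
    then show "loc_map R S \<in> ring_iso R (localization R S)"
      by (rule loc_map_iso)
    fix \<Lambda> :: "'i set" and I
    assume "\<forall>l \<in> \<Lambda>. ideal (I l) R"
    then have "\<And>l. l \<in> \<Lambda> \<Longrightarrow> ideal (I l) R"
      by blast
    from loc_ideal_INT[of \<Lambda> I, OF \<open>S \<subseteq> Units R\<close> this]
    show "loc_ideal R S (carrier R \<inter> (\<Inter>l \<in> \<Lambda>. I l)) =
        carrier (localization R S) \<inter> (\<Inter>l \<in> \<Lambda>. loc_ideal R S (I l))"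
      and "carrier (localization R S) \<inter> (\<Inter>l \<in> \<Lambda>. loc_ideal R S (I l)) =
        loc_map R S ` (carrier R \<inter> (\<Inter>l \<in> \<Lambda>. I l))"
      by simp_all
  qed (use N sat in blast)+
qed

end
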